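(* For every integer $n\ge 0$, $$\sum_{i=0}^{n}\widehat{T}_i=\frac12\big(\widehat{T}_{n+2}+\widehat{T}_n+c_1\big)\qquad\text{and}\qquad \sum_{i=0}^{n}\widehat{K}_i=\frac12\big(\widehat{K}_{n+2}+\widehat{K}_n+c_2\big),$$ where $$c_1=-1-e_1-3e_2-5e_3-9e_4-17e_5-31e_6-57e_7-105e_8-193e_9-355e_{10}-653e_{11}-1201e_{12}-2209e_{13}-4063e_{14}-7473e_{15}$$ and $$c_2=-6e_1-8e_2-14e_3-28e_4-50e_5-92e_6-170e_7-312e_8-574e_9-1056e_{10}-1942e_{11}-3572e_{12}-6570e_{13}-12084e_{14}-22226e_{15}.$$
   Context: The Tribonacci numbers are $T_n=T_{n-1}+T_{n-2}+T_{n-3}$ with $T_0=0,T_1=1,T_2=1$, and the Tribonacci-Lucas numbers are $K_n=K_{n-1}+K_{n-2}+K_{n-3}$ with $K_0=3,K_1=1,K_2=3$. The sedenions $\mathbb{S}$ are the 16-dimensional real Cayley-Dickson algebra (the double of the octonions) with standard basis $e_0,e_1,\dots,e_{15}$, $e_0=1$ the identity (real numbers $a$ are identified with $a e_0$); addition and multiplication by scalars are componentwise. For every integer $n\ge 0$, $\widehat{T}_n=\sum_{s=0}^{15}T_{n+s}e_s$ and $\widehat{K}_n=\sum_{s=0}^{15}K_{n+s}e_s$. *)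

theory Defs
  imports Complex_Main
begin

fun tribonacci :: "nat \<Rightarrow> nat" where
  "tribonacci 0 = 0"
| "tribonacci (Suc 0) = 1"
| "tribonacci (Suc (Suc 0)) = 1"
| "tribonacci (Suc (Suc (Suc n))) =
     tribonacci (Suc (Suc n)) + tribonacci (Suc n) + tribonacci n"

fun tribonacci_lucas :: "nat \<Rightarrow> nat" where
  "tribonacci_lucas 0 = 3"
| "tribonacci_lucas (Suc 0) = 1"
| "tribonacci_lucas (Suc (Suc 0)) = 3"
| "tribonacci_lucas (Suc (Suc (Suc n))) =
     tribonacci_lucas (Suc (Suc n)) + tribonacci_lucas (Suc n) + tribonacci_lucas n"

text \<open>
  Real unital algebras, not necessarily associative or commutative, with a conjugation and a
  distinguished list of basis elements: the structure passed along by the Cayley-Dickson doubling.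
\<close>

class cayley_dickson = real_vector + one + times +
  fixes conj :: "'a \<Rightarrow> 'a"
    and std_basis :: "'a list"
  assumes cd_mult_add_left: "(x + y) * z = x * z + y * z"
    and cd_mult_add_right: "x * (y + z) = x * y + x * z"
    and cd_mult_scaleR_left: "(a *\<^sub>R x) * y = a *\<^sub>R (x * y)"
    and cd_mult_scaleR_right: "x * (a *\<^sub>R y) = a *\<^sub>R (x * y)"
    and cd_one_mult: "1 * x = x"
    and cd_mult_one: "x * 1 = x"
    and cd_conj_add: "conj (x + y) = conj x + conj y"
    and cd_conj_scaleR: "conj (a *\<^sub>R x) = a *\<^sub>R conj x"
    and cd_conj_one: "conj 1 = 1"
    and cd_std_basis_hd: "std_basis \<noteq> []" "hd std_basis = 1"
begin

lemma cd_mult_zero_left: "0 * x = 0"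
  using cd_mult_add_left[of 0 0 x] by simp

lemma cd_mult_zero_right: "x * 0 = 0"
  using cd_mult_add_right[of x 0 0] by simp

lemma cd_conj_zero: "conj 0 = 0"
  using cd_conj_add[of 0 0] by simp

end

instantiation real :: cayley_dickson
begin

definition conj_real :: "real \<Rightarrow> real" where
  "conj_real x = x"

definition std_basis_real :: "real list" where
  "std_basis_real = [1]"

instance
  by standard (simp_all add: conj_real_def std_basis_real_def algebra_simps)

end

datatype 'a double = Dbl (dfst: 'a) (dsnd: 'a)

instantiation double :: (cayley_dickson) cayley_dickson
begin

definition zero_double :: "'a double" where
  "0 = Dbl 0 0"

definition one_double :: "'a double" where
  "1 = Dbl 1 0"

definition plus_double :: "'a double \<Rightarrow> 'a double \<Rightarrow> 'a double" where
  "x + y = Dbl (dfst x + dfst y) (dsnd x + dsnd y)"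

definition minus_double :: "'a double \<Rightarrow> 'a double \<Rightarrow> 'a double" where
  "x - y = Dbl (dfst x - dfst y) (dsnd x - dsnd y)"

definition uminus_double :: "'a double \<Rightarrow> 'a double" where
  "- x = Dbl (- dfst x) (- dsnd x)"

definition scaleR_double :: "real \<Rightarrow> 'a double \<Rightarrow> 'a double" where
  "a *\<^sub>R x = Dbl (a *\<^sub>R dfst x) (a *\<^sub>R dsnd x)"

definition times_double :: "'a double \<Rightarrow> 'a double \<Rightarrow> 'a double" where
  "x * y = Dbl (dfst x * dfst y - conj (dsnd y) * dsnd x)
               (dsnd y * dfst x + dsnd x * conj (dfst y))"

definition conj_double :: "'a double \<Rightarrow> 'a double" where
  "conj x = Dbl (conj (dfst x)) (- dsnd x)"

definition std_basis_double :: "'a double list" where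
  "std_basis = map (\<lambda>x. Dbl x 0) std_basis @ map (\<lambda>x. Dbl 0 x) std_basis"

instance
proof
  show "hd (std_basis :: 'a double list) = 1"
    using cd_std_basis_hd[where 'a = 'a]
    by (simp add: std_basis_double_def one_double_def hd_append hd_map)
qed (simp_all add: zero_double_def one_double_def plus_double_def minus_double_def
      uminus_double_def scaleR_double_def times_double_def conj_double_def std_basis_double_def
      cd_mult_add_left cd_mult_add_right cd_mult_scaleR_left cd_mult_scaleR_right
      cd_one_mult cd_mult_one cd_conj_add cd_conj_scaleR cd_conj_one cd_std_basis_hd
      cd_mult_zero_left cd_mult_zero_right cd_conj_zero scaleR_add_right scaleR_add_left
      scaleR_diff_right algebra_simps)

end

text \<open>
  The first four doublings of the reals are copies of the complex numbers, the quaternions, the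
  octonions and the sedenions.
\<close>

type_synonym sedenion = "real double double double double"

definition e :: "nat \<Rightarrow> sedenion" where
  "e s = std_basis ! s"

lemma length_std_basis_sedenion: "length (std_basis :: sedenion list) = 16"
  by (simp add: std_basis_double_def std_basis_real_def)

lemma e_0: "e 0 = 1"
  using cd_std_basis_hd[where 'a = sedenion] by (simp add: e_def hd_conv_nth)

definition tribonacci_sedenion :: "nat \<Rightarrow> sedenion" where
  "tribonacci_sedenion n = (\<Sum>s=0..15. real (tribonacci (n + s)) *\<^sub>R e s)"

definition tribonacci_lucas_sedenion :: "nat \<Rightarrow> sedenion" where
  "tribonacci_lucas_sedenion n = (\<Sum>s=0..15. real (tribonacci_lucas (n + s)) *\<^sub>R e s)"

definition c1 :: sedenion where
  "c1 = - 1 - e 1 - 3 *\<^sub>R e 2 - 5 *\<^sub>R e 3 - 9 *\<^sub>R e 4 - 17 *\<^sub>R e 5 - 31 *\<^sub>R e 6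
     - 57 *\<^sub>R e 7 - 105 *\<^sub>R e 8 - 193 *\<^sub>R e 9 - 355 *\<^sub>R e 10 - 653 *\<^sub>R e 11
     - 1201 *\<^sub>R e 12 - 2209 *\<^sub>R e 13 - 4063 *\<^sub>R e 14 - 7473 *\<^sub>R e 15"

definition c2 :: sedenion where
  "c2 = - 6 *\<^sub>R e 1 - 8 *\<^sub>R e 2 - 14 *\<^sub>R e 3 - 28 *\<^sub>R e 4 - 50 *\<^sub>R e 5 - 92 *\<^sub>R e 6
     - 170 *\<^sub>R e 7 - 312 *\<^sub>R e 8 - 574 *\<^sub>R e 9 - 1056 *\<^sub>R e 10 - 1942 *\<^sub>R e 11
     - 3572 *\<^sub>R e 12 - 6570 *\<^sub>R e 13 - 12084 *\<^sub>R e 14 - 22226 *\<^sub>R e 15"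

end

theory Submission
  imports Defs
begin

text \<open>
  The identity is linear and comes from the recurrence alone.  In any real vector space, a
  sequence with \<open>x (n + 3) = x (n + 2) + x (n + 1) + x n\<close> satisfies
  \<open>2 (x 0 + \<dots> + x n) = x (n + 2) + x n + (x 0 - x 2)\<close>: passing from \<open>n\<close> to \<open>n + 1\<close> adds
  \<open>2 x (n + 1)\<close> on the left, and on the right the recurrence replaces \<open>x (n + 2) + x n\<close> by
  \<open>x (n + 3) + x (n + 1) = (x (n + 2) + x n) + 2 x (n + 1)\<close>.  Both sedenion sequences inherit the
  scalar recurrence coordinate by coordinate, so only the constant \<open>x 0 - x 2\<close> remains to be
  identified; its coordinates are \<open>T s - T (s + 2)\<close> and \<open>K s - K (s + 2)\<close> for \<open>s \<le> 15\<close>, which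
  are differences of the first eighteen terms.
\<close>

lemma sum_of_tribonacci_recurrence:
  fixes x :: "nat \<Rightarrow> 'a::real_vector"
  assumes rec: "\<And>n. x (n + 3) = x (n + 2) + x (n + 1) + x n"
  shows "(\<Sum>i=0..n. x i) = (1/2) *\<^sub>R (x (n + 2) + x n + (x 0 - x 2))"
proof -
  have double: "2 *\<^sub>R (\<Sum>i=0..n. x i) = x (n + 2) + x n + (x 0 - x 2)"
  proof (induction n)
    case 0
    show ?case by (simp add: scaleR_2 del: add_2_eq_Suc')
  next
    case (Suc n)
    have "x (Suc n + 2) = x (n + 2) + x (n + 1) + x n"
      using rec[of n] by (simp add: numeral_3_eq_3)
    with Suc show ?case by (simp add: scaleR_add_right scaleR_2)
  qed
  show ?thesis unfolding double[symmetric] by simp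
qed

lemma tribonacci_add_3:
  "tribonacci (n + 3) = tribonacci (n + 2) + tribonacci (n + 1) + tribonacci n"
  by (simp add: numeral_eq_Suc)

lemma tribonacci_lucas_add_3:
  "tribonacci_lucas (n + 3) =
     tribonacci_lucas (n + 2) + tribonacci_lucas (n + 1) + tribonacci_lucas n"
  by (simp add: numeral_eq_Suc)

lemma tribonacci_sedenion_add_3:
  "tribonacci_sedenion (n + 3) =
     tribonacci_sedenion (n + 2) + tribonacci_sedenion (n + 1) + tribonacci_sedenion n"
proof -
  have "tribonacci (n + 3 + s) =
      tribonacci (n + 2 + s) + tribonacci (n + 1 + s) + tribonacci (n + s)" for s
    using tribonacci_add_3[of "n + s"] by (simp add: ac_simps)
  then show ?thesis
    unfolding tribonacci_sedenion_def
    by (simp only: of_nat_add scaleR_add_left sum.distrib)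
qed

lemma tribonacci_lucas_sedenion_add_3:
  "tribonacci_lucas_sedenion (n + 3) =
     tribonacci_lucas_sedenion (n + 2) + tribonacci_lucas_sedenion (n + 1)
       + tribonacci_lucas_sedenion n"
proof -
  have "tribonacci_lucas (n + 3 + s) =
      tribonacci_lucas (n + 2 + s) + tribonacci_lucas (n + 1 + s) + tribonacci_lucas (n + s)" for s
    using tribonacci_lucas_add_3[of "n + s"] by (simp add: ac_simps)
  then show ?thesis
    unfolding tribonacci_lucas_sedenion_def
    by (simp only: of_nat_add scaleR_add_left sum.distrib)
qed

text \<open>
  Unfolding the definition of the sequence would branch three ways at every step; taking the
  recurrence at one index at a time reduces each value to three already evaluated ones.
\<close>

lemma tribonacci_values:
  "tribonacci 2 = 1" "tribonacci 3 = 2" "tribonacci 4 = 4" "tribonacci 5 = 7"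
  "tribonacci 6 = 13" "tribonacci 7 = 24" "tribonacci 8 = 44" "tribonacci 9 = 81"
  "tribonacci 10 = 149" "tribonacci 11 = 274" "tribonacci 12 = 504" "tribonacci 13 = 927"
  "tribonacci 14 = 1705" "tribonacci 15 = 3136" "tribonacci 16 = 5768" "tribonacci 17 = 10609"
proof -
  show v2: "tribonacci 2 = 1" by (simp add: numeral_2_eq_2)
  show v3: "tribonacci 3 = 2" using tribonacci_add_3[of 0] v2 by simp
  show v4: "tribonacci 4 = 4" using tribonacci_add_3[of 1] v2 v3 by simp
  show v5: "tribonacci 5 = 7" using tribonacci_add_3[of 2] v2 v3 v4 by simp
  show v6: "tribonacci 6 = 13" using tribonacci_add_3[of 3] v3 v4 v5 by simp
  show v7: "tribonacci 7 = 24" using tribonacci_add_3[of 4] v4 v5 v6 by simp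
  show v8: "tribonacci 8 = 44" using tribonacci_add_3[of 5] v5 v6 v7 by simp
  show v9: "tribonacci 9 = 81" using tribonacci_add_3[of 6] v6 v7 v8 by simp
  show v10: "tribonacci 10 = 149" using tribonacci_add_3[of 7] v7 v8 v9 by simp
  show v11: "tribonacci 11 = 274" using tribonacci_add_3[of 8] v8 v9 v10 by simp
  show v12: "tribonacci 12 = 504" using tribonacci_add_3[of 9] v9 v10 v11 by simp
  show v13: "tribonacci 13 = 927" using tribonacci_add_3[of 10] v10 v11 v12 by simp
  show v14: "tribonacci 14 = 1705" using tribonacci_add_3[of 11] v11 v12 v13 by simp
  show v15: "tribonacci 15 = 3136" using tribonacci_add_3[of 12] v12 v13 v14 by simp
  show v16: "tribonacci 16 = 5768" using tribonacci_add_3[of 13] v13 v14 v15 by simp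
  show "tribonacci 17 = 10609" using tribonacci_add_3[of 14] v14 v15 v16 by simp
qed

lemma tribonacci_lucas_values:
  "tribonacci_lucas 2 = 3" "tribonacci_lucas 3 = 7" "tribonacci_lucas 4 = 11"
  "tribonacci_lucas 5 = 21" "tribonacci_lucas 6 = 39" "tribonacci_lucas 7 = 71"
  "tribonacci_lucas 8 = 131" "tribonacci_lucas 9 = 241" "tribonacci_lucas 10 = 443"
  "tribonacci_lucas 11 = 815" "tribonacci_lucas 12 = 1499" "tribonacci_lucas 13 = 2757"
  "tribonacci_lucas 14 = 5071" "tribonacci_lucas 15 = 9327" "tribonacci_lucas 16 = 17155"
  "tribonacci_lucas 17 = 31553"
proof -
  show v2: "tribonacci_lucas 2 = 3" by (simp add: numeral_2_eq_2)
  show v3: "tribonacci_lucas 3 = 7" using tribonacci_lucas_add_3[of 0] v2 by simp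
  show v4: "tribonacci_lucas 4 = 11" using tribonacci_lucas_add_3[of 1] v2 v3 by simp
  show v5: "tribonacci_lucas 5 = 21" using tribonacci_lucas_add_3[of 2] v2 v3 v4 by simp
  show v6: "tribonacci_lucas 6 = 39" using tribonacci_lucas_add_3[of 3] v3 v4 v5 by simp
  show v7: "tribonacci_lucas 7 = 71" using tribonacci_lucas_add_3[of 4] v4 v5 v6 by simp
  show v8: "tribonacci_lucas 8 = 131" using tribonacci_lucas_add_3[of 5] v5 v6 v7 by simp
  show v9: "tribonacci_lucas 9 = 241" using tribonacci_lucas_add_3[of 6] v6 v7 v8 by simp
  show v10: "tribonacci_lucas 10 = 443" using tribonacci_lucas_add_3[of 7] v7 v8 v9 by simp
  show v11: "tribonacci_lucas 11 = 815" using tribonacci_lucas_add_3[of 8] v8 v9 v10 by simp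
  show v12: "tribonacci_lucas 12 = 1499" using tribonacci_lucas_add_3[of 9] v9 v10 v11 by simp
  show v13: "tribonacci_lucas 13 = 2757" using tribonacci_lucas_add_3[of 10] v10 v11 v12 by simp
  show v14: "tribonacci_lucas 14 = 5071" using tribonacci_lucas_add_3[of 11] v11 v12 v13 by simp
  show v15: "tribonacci_lucas 15 = 9327" using tribonacci_lucas_add_3[of 12] v12 v13 v14 by simp
  show v16: "tribonacci_lucas 16 = 17155" using tribonacci_lucas_add_3[of 13] v13 v14 v15 by simp
  show "tribonacci_lucas 17 = 31553" using tribonacci_lucas_add_3[of 14] v14 v15 v16 by simp
qed

lemma sum_0_15:
  fixes f :: "nat \<Rightarrow> 'a::comm_monoid_add"
  shows "(\<Sum>s=0..15. f s) = f 0 + f 1 + f 2 + f 3 + f 4 + f 5 + f 6 + f 7 + f 8 + f 9 + f 10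
    + f 11 + f 12 + f 13 + f 14 + f 15"
  by (simp add: numeral_eq_Suc ac_simps)

lemma c1_eq: "c1 = tribonacci_sedenion 0 - tribonacci_sedenion 2"
proof -
  have "tribonacci_sedenion 0 - tribonacci_sedenion 2 =
      (\<Sum>s=0..15. (real (tribonacci s) - real (tribonacci (2 + s))) *\<^sub>R e s)"
    by (simp only: tribonacci_sedenion_def sum_subtractf scaleR_diff_left add_0)
  also have "\<dots> = c1"
    by (simp add: sum_0_15 tribonacci_values c1_def e_0)
  finally show ?thesis ..
qed

lemma c2_eq: "c2 = tribonacci_lucas_sedenion 0 - tribonacci_lucas_sedenion 2"
proof -
  have "tribonacci_lucas_sedenion 0 - tribonacci_lucas_sedenion 2 =
      (\<Sum>s=0..15. (real (tribonacci_lucas s) - real (tribonacci_lucas (2 + s))) *\<^sub>R e s)"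
    by (simp only: tribonacci_lucas_sedenion_def sum_subtractf scaleR_diff_left add_0)
  also have "\<dots> = c2"
    by (simp add: sum_0_15 tribonacci_lucas_values c2_def)
  finally show ?thesis ..
qed

theorem theorem2p7:
  fixes n :: nat
  shows "(\<Sum>i=0..n. tribonacci_sedenion i) =
           (1/2) *\<^sub>R (tribonacci_sedenion (n + 2) + tribonacci_sedenion n + c1) \<and>
         (\<Sum>i=0..n. tribonacci_lucas_sedenion i) =
           (1/2) *\<^sub>R (tribonacci_lucas_sedenion (n + 2) + tribonacci_lucas_sedenion n + c2)"
  unfolding c1_eq c2_eq
  by (intro conjI sum_of_tribonacci_recurrence
      tribonacci_sedenion_add_3 tribonacci_lucas_sedenion_add_3)

end
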